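(* Let $\lambda_1,\lambda_2 \in \mathbb{N}$ be two coprime positive integers and let $S=\{0,\lambda_1,\lambda_1+\lambda_2\}$. Then \[ d_p(S) = \max \left (\frac{\lfloor \frac{1}{3}( \lambda_1+2\lambda_2)\rfloor}{\lambda_1+2\lambda_2},\frac{\lfloor \frac{1}{3}( 2\lambda_1+\lambda_2)\rfloor}{2\lambda_1+\lambda_2}\right) \] and \[ d_c(S) = \min \left (\frac{\lceil \frac{1}{3}( \lambda_1+2\lambda_2)\rceil}{\lambda_1+2\lambda_2},\frac{\lceil \frac{1}{3}( 2\lambda_1+\lambda_2)\rceil}{2\lambda_1+\lambda_2}\right). \]
   Context: For $A\subset\mathbb{Z}$, the upper density is $\overline{d}(A)=\limsup_{n\to\infty}\frac{|A\cap[-n,n]|}{2n+1}$ and the lower density is $\underline{d}(A)=\liminf_{n\to\infty}\frac{|A\cap[-n,n]|}{2n+1}$. For $S\subset\mathbb{Z}$ and $t\in\mathbb{Z}$, $S+t=\{s+t:s\in S\}$ is a translate of $S$. A set $A\subset\mathbb{Z}$ is $S$-packing if $S+a_1$ and $S+a_2$ are disjoint for all distinct $a_1,a_2\in A$; $d_p(S)$ is the supremum of $\overline{d}(A)$ over all $S$-packing sets $A\subset\mathbb{Z}$. A set $A\subset\mathbb{Z}$ is $S$-covering if every $t\in\mathbb{Z}$ lies in some $S+a$ with $a\in A$; $d_c(S)$ is the infimum of $\underline{d}(A)$ over all $S$-covering sets $A\subset\mathbb{Z}$. *)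

theory Defs
  imports "HOL-Analysis.Analysis"
begin

(* Densities take values in ereal, a complete lattice, so that limsup, liminf, SUP and INF
   are genuine suprema and infima without boundedness or nonemptiness side conditions. *)

definition upper_density :: "int set \<Rightarrow> ereal" where
  "upper_density A =
     limsup (\<lambda>n. ereal (real (card (A \<inter> {- int n..int n})) / (2 * real n + 1)))"

definition lower_density :: "int set \<Rightarrow> ereal" where
  "lower_density A =
     liminf (\<lambda>n. ereal (real (card (A \<inter> {- int n..int n})) / (2 * real n + 1)))"

definition translate :: "int set \<Rightarrow> int \<Rightarrow> int set" where
  "translate S t = {s + t | s. s \<in> S}"

definition packing_set :: "int set \<Rightarrow> int set \<Rightarrow> bool" where
  "packing_set S A \<longleftrightarrow>
     (\<forall>a1\<in>A. \<forall>a2\<in>A. a1 \<noteq> a2 \<longrightarrow> translate S a1 \<inter> translate S a2 = {})"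

definition covering_set :: "int set \<Rightarrow> int set \<Rightarrow> bool" where
  "covering_set S A \<longleftrightarrow> (\<forall>t. \<exists>a\<in>A. t \<in> translate S a)"

definition packing_density :: "int set \<Rightarrow> ereal" where
  "packing_density S = (SUP A\<in>{A. packing_set S A}. upper_density A)"

definition covering_density :: "int set \<Rightarrow> ereal" where
  "covering_density S = (INF A\<in>{A. covering_set S A}. lower_density A)"

end

theory Submission
  imports Defs "HOL-Real_Asymp.Real_Asymp"
begin

text \<open>Write \<open>a = \<lambda>\<^sub>1\<close>, \<open>b = \<lambda>\<^sub>2\<close> and let \<open>f\<close> be the indicator function of \<open>A\<close>. Joining integers
  that differ by \<open>a\<close>, \<open>b\<close> or \<open>a + b\<close> gives a quotient of the triangular lattice. A packing set
  meets every triangle \<open>{w, w + b, w + a + b}\<close> and \<open>{w, w + a, w + a + b}\<close> at most once, and a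
  covering set meets every triangle of the first kind at least once.

  Let \<open>N = 2 a + b\<close> and \<open>M(y) = |A \<inter> [y, y + 2 a + 2 b)| + |A \<inter> [y + b, y + 2 a + b)|\<close>. Then
  \<open>3 M(y)\<close> is a sum of \<open>f\<close> over \<open>2 N\<close> triangles, paired into rhombi. For a packing set this gives
  \<open>3 M(y) \<le> 2 N\<close>, so \<open>M(y) \<le> \<lfloor>2 N / 3\<rfloor>\<close>, while the mean of \<open>M\<close> is \<open>2 N\<close> times the density. For a
  covering set the triangles of the second kind may be missed, but adding to \<open>M\<close> an
  integer-valued quadratic expression in \<open>f\<close> of mean zero makes the contribution of every rhombus
  sufficiently large, whence the density is at least \<open>\<lceil>2 N / 3\<rceil> / (2 N)\<close>. By symmetry the same
  holds for \<open>a + 2 b\<close>, and the two numbers add up to \<open>0\<close> modulo \<open>3\<close>, so that for one of them the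
  factors \<open>2\<close> cancel.

  Conversely, modulo \<open>a + 2 b\<close> the set \<open>{0, a, a + b}\<close> is \<open>{0, -2 b, -b}\<close>, and modulo \<open>2 a + b\<close>
  it is \<open>{0, a, -a}\<close>: up to a unit, an interval of three residues, for which periodic packings
  and coverings are immediate.\<close>

text \<open>The arithmetic of functions with mean zero, in the form that their sums over all symmetric
  intervals are bounded.\<close>

definition bounded_sums :: "(int \<Rightarrow> int) \<Rightarrow> bool" where
  "bounded_sums g \<longleftrightarrow> (\<exists>C. \<forall>n::nat. \<bar>\<Sum>x=-int n..int n. g x\<bar> \<le> C)"

lemma bounded_sums_0: "bounded_sums (\<lambda>_. 0)"
  by (auto simp: bounded_sums_def)

lemma bounded_sums_add:
  assumes "bounded_sums g" "bounded_sums h"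
  shows "bounded_sums (\<lambda>x. g x + h x)"
proof -
  obtain C D where "\<And>n::nat. \<bar>\<Sum>x=-int n..int n. g x\<bar> \<le> C" "\<And>n::nat. \<bar>\<Sum>x=-int n..int n. h x\<bar> \<le> D"
    using assms by (auto simp: bounded_sums_def)
  then have "\<bar>\<Sum>x=-int n..int n. g x + h x\<bar> \<le> C + D" for n :: nat
    unfolding sum.distrib by (meson abs_triangle_ineq add_mono order_trans)
  then show ?thesis by (auto simp: bounded_sums_def)
qed

lemma bounded_sums_cmult:
  assumes "bounded_sums g"
  shows "bounded_sums (\<lambda>x. c * g x)"
proof -
  obtain C where "\<And>n::nat. \<bar>\<Sum>x=-int n..int n. g x\<bar> \<le> C"
    using assms by (auto simp: bounded_sums_def)
  then have "\<bar>\<Sum>x=-int n..int n. c * g x\<bar> \<le> \<bar>c\<bar> * C" for n :: nat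
    by (simp add: sum_distrib_left[symmetric] abs_mult mult_left_mono)
  then show ?thesis by (auto simp: bounded_sums_def)
qed

lemma bounded_sums_diff:
  assumes "bounded_sums g" "bounded_sums h"
  shows "bounded_sums (\<lambda>x. g x - h x)"
  using bounded_sums_add[OF assms(1) bounded_sums_cmult[OF assms(2), of "-1"]] by simp

lemma bounded_sums_sum:
  assumes "finite I" "\<And>i. i \<in> I \<Longrightarrow> bounded_sums (g i)"
  shows "bounded_sums (\<lambda>x. \<Sum>i\<in>I. g i x)"
  using assms by (induction rule: finite_induct) (auto intro: bounded_sums_0 bounded_sums_add)

lemma bounded_sums_reflect:
  assumes "bounded_sums g"
  shows "bounded_sums (\<lambda>x. g (- x))"
proof -
  have "(\<Sum>x=-int n..int n. g (- x)) = (\<Sum>x=-int n..int n. g x)" for n :: nat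
    by (rule sum.reindex_bij_witness[of _ uminus uminus]) auto
  then show ?thesis using assms by (simp add: bounded_sums_def)
qed

lemma bounded_sums_shift1:
  fixes g :: "int \<Rightarrow> int"
  assumes "\<And>x. \<bar>g x\<bar> \<le> B"
  shows "bounded_sums (\<lambda>x. g (x + 1) - g x)"
proof -
  have "(\<Sum>x=-int n..int n. g (x + 1) - g x) = g (int n + 1) - g (- int n)" for n :: nat
  proof (induction n)
    case (Suc n)
    have "{- int (Suc n)..int (Suc n)} = insert (- 1 - int n) (insert (1 + int n) {- int n..int n})"
      by auto
    then show ?case using Suc by (simp add: algebra_simps)
  qed simp
  moreover have "\<bar>g (int n + 1) - g (- int n)\<bar> \<le> 2 * B" for n :: nat
    using assms[of "int n + 1"] assms[of "- int n"] by linarith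
  ultimately show ?thesis by (auto simp: bounded_sums_def)
qed

lemma bounded_sums_shift:
  fixes g :: "int \<Rightarrow> int"
  assumes "\<And>x. \<bar>g x\<bar> \<le> B"
  shows "bounded_sums (\<lambda>x. g (x + d) - g x)"
proof (induction d rule: int_induct[where k = 0])
  case base
  show ?case by (simp add: bounded_sums_0)
next
  case (step1 d)
  have "bounded_sums (\<lambda>x. g (x + 1 + d) - g (x + d))"
    using bounded_sums_shift1[of "\<lambda>x. g (x + d)"] assms by blast
  from bounded_sums_add[OF this step1(2)] show ?case by (simp add: algebra_simps)
next
  case (step2 d)
  have "bounded_sums (\<lambda>x. g (x + 1 + (d - 1)) - g (x + (d - 1)))"
    using bounded_sums_shift1[of "\<lambda>x. g (x + (d - 1))"] assms by blast
  from bounded_sums_diff[OF step2(2) this] show ?case by (simp add: algebra_simps)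
qed

section \<open>Sums over sliding windows\<close>

lemma sum_int_shift:
  fixes g :: "int \<Rightarrow> int"
  shows "(\<Sum>x\<in>{p..<q}. g (x + d)) = (\<Sum>x\<in>{p + d..<q + d}. g x)"
  by (rule sum.reindex_bij_witness[of _ "\<lambda>x. x - d" "\<lambda>x. x + d"]) auto

text \<open>The window sum adds up \<open>q - p\<close> translates of \<open>g\<close>, each
  differing from \<open>g\<close> by a function of mean zero.\<close>

lemma bounded_sums_window:
  fixes g :: "int \<Rightarrow> int"
  assumes "\<And>x. \<bar>g x\<bar> \<le> B" "p \<le> q"
  shows "bounded_sums (\<lambda>y. (\<Sum>x\<in>{y + p..<y + q}. g x) - (q - p) * g y)"
proof -
  have "bounded_sums (\<lambda>y. \<Sum>j\<in>{p..<q}. g (y + j) - g y)"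
    by (intro bounded_sums_sum bounded_sums_shift[OF assms(1)]) auto
  moreover have "(\<Sum>j\<in>{p..<q}. g (y + j) - g y) = (\<Sum>x\<in>{y + p..<y + q}. g x) - (q - p) * g y" for y
    using sum_int_shift[of g y p q] assms(2) by (simp add: sum_subtractf add.commute)
  ultimately show ?thesis by simp
qed

lemma bounded_sums_window_null:
  fixes g :: "int \<Rightarrow> int"
  assumes "\<And>x. \<bar>g x\<bar> \<le> B" "p \<le> q" "bounded_sums g"
  shows "bounded_sums (\<lambda>y. \<Sum>x\<in>{y + p..<y + q}. g x)"
  using bounded_sums_add[OF bounded_sums_window[of g B p q, OF assms(1,2)] bounded_sums_cmult[OF assms(3), of "q - p"]]
  by simp

section \<open>Rhombi in the triangular lattice and the local inequalities\<close>

text \<open>A rhombus gives weight 2 to the ends of its common edge and 1 to its apexes. With the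
  first type of rhombus counted twice, the endpoints of the shifted intervals cancel except
  \<open>y\<close>, \<open>y + b\<close>, \<open>y + 2*a + b\<close> and
  \<open>y + 2*a + 2*b\<close>, leaving weight 3 on both windows.\<close>

lemma rhombus_sum_identity:
  fixes f :: "int \<Rightarrow> int"
  assumes "a \<ge> 0" "b \<ge> 0"
  shows "3 * ((\<Sum>x\<in>{y..<y + (2*a + 2*b)}. f x) + (\<Sum>x\<in>{y + b..<y + (2*a + b)}. f x)) =
    2 * (\<Sum>v\<in>{y..<y + a}. (f v + f (v + b) + f (v + (a + b))) + (f (v + b) + f (v + (a + b)) + f (v
        + (a + 2*b)))) +
    (\<Sum>v\<in>{y + a..<y + (a + b)}. (f v + f (v + b) + f (v + (a + b))) + (f (v + (- a)) + f v + f (v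
        + b)))"
proof -
  \<comment> \<open>Prefix sums make both sides linear in the values of \<open>D\<close>, whichever
    of \<open>a\<close> and \<open>b\<close> is larger.\<close>
  define D where "D p = (\<Sum>x\<in>{y..<p}. f x)" for p
  have D: "(\<Sum>x\<in>{p..<q}. f x) = D q - D p" if "y \<le> p" "p \<le> q" for p q
  proof -
    have "{y..<q} = {y..<p} \<union> {p..<q}" using that by auto
    then show ?thesis by (simp add: D_def sum.union_disjoint)
  qed
  show ?thesis
    unfolding sum.distrib sum_int_shift using assms by (simp add: D algebra_simps)
qed

lemma packing_upper_bound:
  fixes f :: "int \<Rightarrow> int"
  assumes "a \<ge> 0" "b \<ge> 0"
    and "\<And>w. f w \<in> {0, 1}"
    and t1: "\<And>w. f w + f (w + b) + f (w + (a + b)) \<le> 1"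
    and t3: "\<And>w. f w + f (w + a) + f (w + (a + b)) \<le> 1"
  obtains h where "bounded_sums (\<lambda>y. h y - 2 * (2*a + b) * f y)" "\<And>y. 3 * h y \<le> 2 * (2*a + b)"
proof
  let ?h = "\<lambda>y. (\<Sum>x\<in>{y + 0..<y + (2*a + 2*b)}. f x) + (\<Sum>x\<in>{y + b..<y + (2*a + b)}. f x)"
  have "\<bar>f x\<bar> \<le> 1" for x using assms(3)[of x] by auto
  note w = bounded_sums_window[OF this]
  have "bounded_sums (\<lambda>y. ((\<Sum>x\<in>{y + 0..<y + (2*a + 2*b)}. f x) - (2*a + 2*b - 0) * f y) +
      ((\<Sum>x\<in>{y + b..<y + (2*a + b)}. f x) - (2*a + b - b) * f y))"
    using assms by (intro bounded_sums_add w) auto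
  then show "bounded_sums (\<lambda>y. ?h y - 2 * (2*a + b) * f y)"
    by (simp add: algebra_simps)
  show "3 * ?h y \<le> 2 * (2*a + b)" for y
  proof -
    \<comment> \<open>Each rhombus consists of one triangle of either kind: the second is
      \<open>t3\<close> at \<open>v + b\<close> here and at \<open>v - a\<close> below.\<close>
    have "(f v + f (v + b) + f (v + (a + b))) + (f (v + b) + f (v + (a + b)) + f (v + (a + 2*b)))
        \<le> 2" for v
      using t1[of v] t3[of "v + b"] by (simp add: algebra_simps)
    then have "(\<Sum>v\<in>{y..<y + a}. (f v + f (v + b) + f (v + (a + b))) + (f (v + b) + f (v + (a + b))
        + f (v + (a + 2*b)))) \<le> (\<Sum>v\<in>{y..<y + a}. 2)"
      by (intro sum_mono)
    moreover have "(f v + f (v + b) + f (v + (a + b))) + (f (v + (- a)) + f v + f (v + b))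
        \<le> 2" for v
      using t1[of v] t3[of "v + (- a)"] by (simp add: algebra_simps)
    then have "(\<Sum>v\<in>{y + a..<y + (a + b)}. (f v + f (v + b) + f (v + (a + b))) + (f (v + (- a))
        + f v + f (v + b))) \<le> (\<Sum>v\<in>{y + a..<y + (a + b)}. 2)"
      by (intro sum_mono)
    ultimately show ?thesis
      using rhombus_sum_identity[OF assms(1,2), of f y] assms(1,2) by simp
  qed
qed

text \<open>The correction term of a rhombus made of two triangles with common edge \<open>u v\<close> and
  apexes \<open>p\<close> and \<open>q\<close>, where only the triangle \<open>u v p\<close> is known to be hit. Its translates have
  mean zero, and three times it turns the excess of the rhombus into a nonnegative number.\<close>

definition rhombus_correction :: "int \<Rightarrow> int \<Rightarrow> int \<Rightarrow> int \<Rightarrow> int" where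
  "rhombus_correction u v p q = (q - p) * (u + v - 1)"

text \<open>If \<open>u + v = 1\<close>, the correction vanishes and the sum is
  \<open>2 + p + q\<close>. If \<open>u + v = 0\<close>, then \<open>p = 1\<close> and it is
  \<open>4 - 2*q\<close>. If \<open>u + v = 2\<close>, it is \<open>4 + 4*q - 2*p\<close>.\<close>

lemma rhombus_corrected_ge:
  assumes "u \<in> {0,1}" "v \<in> {0,1}" "p \<in> {0,1}" "q \<in> {0,1}" "u + v + p \<ge> 1"
  shows "(u + v + p) + (u + v + q) + 3 * rhombus_correction u v p q \<ge> 2"
  using assms by (auto simp: rhombus_correction_def)

lemma rhombus_correction_abs_le:
  assumes "u \<in> {0,1}" "v \<in> {0,1}" "p \<in> {0,1}" "q \<in> {0,1}"
  shows "\<bar>rhombus_correction u v p q\<bar> \<le> 1"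
  using assms by (auto simp: rhombus_correction_def)

lemma covering_lower_bound:
  fixes f :: "int \<Rightarrow> int"
  assumes "a \<ge> 0" "b \<ge> 0"
    and f01: "\<And>w. f w \<in> {0, 1}"
    and t1: "\<And>w. f w + f (w + b) + f (w + (a + b)) \<ge> 1"
  obtains h where "bounded_sums (\<lambda>y. h y - 2 * (2*a + b) * f y)" "\<And>y. 3 * h y \<ge> 2 * (2*a + b)"
proof
  define cA where "cA v = rhombus_correction (f (v + b)) (f (v + (a + b))) (f v) (f (v + (a
      + 2*b)))" for v
  define cB where "cB v = rhombus_correction (f v) (f (v + b)) (f (v + (a + b))) (f (v + (- a)))"
      for v
  let ?m = "\<lambda>y. (\<Sum>x\<in>{y + 0..<y + (2*a + 2*b)}. f x) + (\<Sum>x\<in>{y + b..<y + (2*a + b)}. f x)"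
  \<comment> \<open>The weights 2 and 1 are those of \<open>rhombus_sum_identity\<close>, so
    \<open>3 * ?h y\<close> is again a sum over rhombi, each now with its correction.\<close>
  let ?h = "\<lambda>y. ?m y + (2 * (\<Sum>v\<in>{y + 0..<y + a}. cA v) + (\<Sum>v\<in>{y + a..<y + (a + b)}. cB v))"
  have absf: "\<bar>f x\<bar> \<le> 1" for x using f01[of x] by auto
  \<comment> \<open>Opposite sides of a rhombus are parallel, so the products along them in the
    expanded correction are translates of one \<open>g d\<close> with opposite signs.\<close>
  define g where "g d x = f x * f (x + d)" for d x
  have absg: "\<bar>g d x\<bar> \<le> 1" for d x using f01[of x] f01[of "x + d"] by (auto simp: g_def)
  note sf = bounded_sums_shift[of f, OF absf] and sg = bounded_sums_shift[of "g _", OF absg]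
  have "bounded_sums (\<lambda>v. (g (a + b) (v + b) - g (a + b) v) + (g b (v + (a + b)) - g b v) - (f (v
      + (a + 2*b)) - f v))"
    by (intro bounded_sums_add bounded_sums_diff sf sg)
  also have "(\<lambda>v. (g (a + b) (v + b) - g (a + b) v) + (g b (v + (a + b)) - g b v) - (f (v + (a
      + 2*b)) - f v)) = cA"
    by (rule ext) (simp add: g_def cA_def rhombus_correction_def algebra_simps)
  finally have nA: "bounded_sums cA" .
  \<comment> \<open>The terms \<open>g a v\<close> and \<open>f v\<close> cancel; they split a
    difference of two translates into two shifts from \<open>v\<close>.\<close>
  have "bounded_sums (\<lambda>v. ((g a (v + (- a)) - g a v) - (g a (v + b) - g a v)) + (g (a + b) (v
      + (- a)) - g (a + b) v)
      + ((f (v + (a + b)) - f v) - (f (v + (- a)) - f v)))"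
    by (intro bounded_sums_add bounded_sums_diff sf sg)
  also have "(\<lambda>v. ((g a (v + (- a)) - g a v) - (g a (v + b) - g a v)) + (g (a + b) (v
      + (- a)) - g (a + b) v)
      + ((f (v + (a + b)) - f v) - (f (v + (- a)) - f v))) = cB"
    by (rule ext) (simp add: g_def cB_def rhombus_correction_def algebra_simps)
  finally have nB: "bounded_sums cB" .
  have absA: "\<bar>cA v\<bar> \<le> 1" and absB: "\<bar>cB v\<bar> \<le> 1" for v
    unfolding cA_def cB_def by (intro rhombus_correction_abs_le f01)+
  have "bounded_sums (\<lambda>y. ((\<Sum>x\<in>{y + 0..<y + (2*a + 2*b)}. f x) - (2*a + 2*b - 0) * f y) +
      ((\<Sum>x\<in>{y + b..<y + (2*a + b)}. f x) - (2*a + b - b) * f y) +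
      (2 * (\<Sum>v\<in>{y + 0..<y + a}. cA v) + (\<Sum>v\<in>{y + a..<y + (a + b)}. cB v)))"
    using assms(1,2)
    by (intro bounded_sums_add bounded_sums_cmult bounded_sums_window[OF absf]
        bounded_sums_window_null[OF absA _ nA] bounded_sums_window_null[OF absB _ nB]) auto
  then show "bounded_sums (\<lambda>y. ?h y - 2 * (2*a + b) * f y)"
    by (simp add: algebra_simps)
  show "3 * ?h y \<ge> 2 * (2*a + b)" for y
  proof -
    let ?A = "\<lambda>v. (f v + f (v + b) + f (v + (a + b))) + (f (v + b) + f (v + (a + b)) + f (v + (a
        + 2*b)))"
    let ?B = "\<lambda>v. (f v + f (v + b) + f (v + (a + b))) + (f (v + (- a)) + f v + f (v + b))"
    have "2 \<le> ?A v + 3 * cA v" for v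
      using rhombus_corrected_ge[OF f01 f01 f01 f01, of "v + b"
          "v + (a + b)" v "v + (a + 2*b)"] t1[of v]
      by (simp add: cA_def algebra_simps)
    then have "(\<Sum>v\<in>{y..<y + a}. 2) \<le> (\<Sum>v\<in>{y..<y + a}. ?A v + 3 * cA v)"
      by (intro sum_mono)
    then have A: "2 * a \<le> (\<Sum>v\<in>{y..<y + a}. ?A v) + 3 * (\<Sum>v\<in>{y..<y + a}. cA v)"
      using assms(1) unfolding sum.distrib[of ?A] sum_distrib_left[symmetric] by simp
    have "2 \<le> ?B v + 3 * cB v" for v
      using rhombus_corrected_ge[OF f01 f01 f01 f01, of v "v + b" "v + (a + b)"
          "v + (- a)"] t1[of v]
      by (simp add: cB_def algebra_simps)
    then have "(\<Sum>v\<in>{y + a..<y + (a + b)}. 2) \<le> (\<Sum>v\<in>{y + a..<y + (a + b)}. ?B v + 3 * cB v)"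
      by (intro sum_mono)
    then have B: "2 * b \<le> (\<Sum>v\<in>{y + a..<y + (a + b)}. ?B v) + 3 * (\<Sum>v\<in>{y + a..<y + (a + b)}. cB v)"
      using assms(2) unfolding sum.distrib[of ?B] sum_distrib_left[symmetric] by simp
    show ?thesis
      using rhombus_sum_identity[OF assms(1,2), of f y] A B by simp
  qed
qed

section \<open>From local bounds to densities\<close>

lemma card_eq_sum_of_bool:
  fixes A B :: "int set"
  assumes "finite B"
  shows "int (card (A \<inter> B)) = (\<Sum>x\<in>B. of_bool (x \<in> A))"
  using assms by (simp add: of_bool_def sum.If_cases Int_commute)

lemma quotient_bounds:
  fixes N K C c m :: real
  assumes "N > 0" "m > 0"
  shows "N * c \<le> K * m + C \<Longrightarrow> c / m \<le> K / N + (C / N) / m"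
    and "N * c \<ge> K * m - C \<Longrightarrow> c / m \<ge> K / N - (C / N) / m"
proof -
  have le: "c / m \<le> K / N + (C / N) / m" if "N * c \<le> K * m + C" for c K
    using that assms by (simp add: field_simps)
  then show "N * c \<le> K * m + C \<Longrightarrow> c / m \<le> K / N + (C / N) / m" .
  show "N * c \<ge> K * m - C \<Longrightarrow> c / m \<ge> K / N - (C / N) / m"
    using le[of "- c" "- K"] by simp
qed

text \<open>Over \<open>[-n, n]\<close> the sum of \<open>h\<close> is \<open>N\<close> times the
  count of \<open>A\<close> up to a constant, and it is at most \<open>K * (2*n + 1)\<close>.
  Division leaves an error of order \<open>1/n\<close>.\<close>

lemma upper_density_le:
  fixes N K :: int
  assumes "bounded_sums (\<lambda>y. h y - N * of_bool (y \<in> A))" "\<And>y. h y \<le> K" "N > 0"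
  shows "upper_density A \<le> ereal (K / N)"
proof -
  let ?c = "\<lambda>n::nat. card (A \<inter> {- int n..int n})"
  obtain C where C: "\<And>n::nat. \<bar>\<Sum>y=-int n..int n. h y - N * of_bool (y \<in> A)\<bar> \<le> C"
    using assms(1) by (auto simp: bounded_sums_def)
  have "real (?c n) / (2 * real n + 1) \<le> K / N + (C / N) / (2 * real n + 1)" for n
  proof -
    have "(\<Sum>y=-int n..int n. h y - N * of_bool (y \<in> A)) = (\<Sum>y=-int n..int n. h y) - N * int (?c n)"
      by (simp add: sum_subtractf sum_distrib_left card_eq_sum_of_bool)
    moreover have "(\<Sum>y=-int n..int n. h y) \<le> (\<Sum>y=-int n..int n. K)"
      by (intro sum_mono assms(2))
    ultimately have "N * int (?c n) \<le> K * (2 * int n + 1) + C"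
      using C[of n] by (simp add: algebra_simps)
    then have "real_of_int (N * int (?c n)) \<le> of_int (K * (2 * int n + 1) + C)"
      by (simp only: of_int_le_iff)
    then show ?thesis using assms(3) by (intro quotient_bounds) simp_all
  qed
  then have "upper_density A \<le> limsup (\<lambda>n. ereal (K / N + (C / N) / (2 * real n + 1)))"
    unfolding upper_density_def by (intro Limsup_mono always_eventually) simp
  also have "(\<lambda>n. K / N + (C / N) / (2 * real n + 1)) \<longlonglongrightarrow> K / N"
    by real_asymp
  then have "limsup (\<lambda>n. ereal (K / N + (C / N) / (2 * real n + 1))) = ereal (K / N)"
    by (intro lim_imp_Limsup) auto
  finally show ?thesis .
qed

lemma lower_density_ge:
  fixes N K :: int
  assumes "bounded_sums (\<lambda>y. h y - N * of_bool (y \<in> A))" "\<And>y. h y \<ge> K" "N > 0"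
  shows "lower_density A \<ge> ereal (K / N)"
proof -
  let ?c = "\<lambda>n::nat. card (A \<inter> {- int n..int n})"
  obtain C where C: "\<And>n::nat. \<bar>\<Sum>y=-int n..int n. h y - N * of_bool (y \<in> A)\<bar> \<le> C"
    using assms(1) by (auto simp: bounded_sums_def)
  have ge: "real (?c n) / (2 * real n + 1) \<ge> K / N - (C / N) / (2 * real n + 1)" for n
  proof -
    have "(\<Sum>y=-int n..int n. h y - N * of_bool (y \<in> A)) = (\<Sum>y=-int n..int n. h y) - N * int (?c n)"
      by (simp add: sum_subtractf sum_distrib_left card_eq_sum_of_bool)
    moreover have "(\<Sum>y=-int n..int n. h y) \<ge> (\<Sum>y=-int n..int n. K)"
      by (intro sum_mono assms(2))
    ultimately have "N * int (?c n) \<ge> K * (2 * int n + 1) - C"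
      using C[of n] by (simp add: algebra_simps)
    then have "real_of_int (N * int (?c n)) \<ge> of_int (K * (2 * int n + 1) - C)"
      by (simp only: of_int_le_iff)
    then show ?thesis using assms(3) by (intro quotient_bounds) simp_all
  qed
  have "(\<lambda>n. K / N - (C / N) / (2 * real n + 1)) \<longlonglongrightarrow> K / N"
    by real_asymp
  then have "ereal (K / N) = liminf (\<lambda>n. ereal (K / N - (C / N) / (2 * real n + 1)))"
    by (intro lim_imp_Liminf[symmetric]) auto
  also have "\<dots> \<le> lower_density A"
    unfolding lower_density_def using ge by (intro Liminf_mono always_eventually) simp
  finally show ?thesis .
qed

lemma lower_density_le_upper_density: "lower_density A \<le> upper_density A"
  unfolding lower_density_def upper_density_def by (rule Liminf_le_Limsup) simp

section \<open>Density bounds for arbitrary packings and coverings\<close>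

text \<open>Two translates meet exactly when their offsets differ by a difference of two elements of
  the set; up to sign, the nonzero ones are \<open>a\<close>, \<open>b\<close> and
  \<open>a + b\<close>.\<close>

lemma packing_set_iff:
  assumes "a > 0" "b > 0"
  shows "packing_set {0, a, a + b} A \<longleftrightarrow> (\<forall>x\<in>A. x + a \<notin> A \<and> x + b \<notin> A \<and> x + (a + b) \<notin> A)"
    (is "?L \<longleftrightarrow> ?R")
proof
  assume L: ?L
  have "\<not> (s + x = t + y)" if "x \<in> A" "y \<in> A" "x \<noteq> y" "s \<in> {0, a, a + b}"
      "t \<in> {0, a, a + b}" for x y s t
    using L that unfolding packing_set_def translate_def by blast
  note * = this
  show ?R
  proof (intro ballI conjI notI)
    fix x assume "x \<in> A"
    show False if "x + a \<in> A" using *[of x "x + a" a 0] that \<open>x \<in> A\<close> assms by simp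
    show False if "x + b \<in> A" using *[of x "x + b" "a + b" a] that \<open>x \<in> A\<close> assms by simp
    show False if "x + (a + b) \<in> A" using *[of x "x + (a + b)" "a + b" 0] that \<open>x \<in> A\<close> assms by simp
  qed
next
  assume R: ?R
  show ?L unfolding packing_set_def
  proof (intro ballI impI)
    fix x y assume xy: "x \<in> A" "y \<in> A" "x \<noteq> y"
    have "y \<notin> {x + a, x + b, x + (a + b)}" "x \<notin> {y + a, y + b, y + (a + b)}"
      using R xy by auto
    then show "translate {0, a, a + b} x \<inter> translate {0, a, a + b} y = {}"
      using xy by (auto simp: translate_def)
  qed
qed

lemma covering_set_iff:
  "covering_set {0, a, a + b} A \<longleftrightarrow> (\<forall>t. t \<in> A \<or> t - a \<in> A \<or> t - (a + b) \<in> A)"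
proof -
  have "(\<exists>x\<in>A. t \<in> translate {0, a, a + b} x) \<longleftrightarrow> t \<in> A \<or> t - a \<in> A \<or> t - (a + b) \<in> A" for t
  proof
    assume "t \<in> A \<or> t - a \<in> A \<or> t - (a + b) \<in> A"
    then show "\<exists>x\<in>A. t \<in> translate {0, a, a + b} x"
      by (elim disjE) (force simp: translate_def)+
  qed (auto simp: translate_def)
  then show ?thesis by (simp add: covering_set_def)
qed

lemma upper_density_packing_le:
  fixes a b :: int
  assumes "a > 0" "b > 0" "\<And>x. x \<in> A \<Longrightarrow> x + a \<notin> A \<and> x + b \<notin> A \<and> x + (a + b) \<notin> A"
  shows "upper_density A \<le> ereal (real_of_int ((2 * (2*a + b)) div 3) / (2 * (2*a + b)))"
proof -
  define f :: "int \<Rightarrow> int" where "f x = of_bool (x \<in> A)" for x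
  have "f w + f (w + b) + f (w + (a + b)) \<le> 1" "f w + f (w + a) + f (w + (a + b)) \<le> 1" for w
    using assms(3)[of w] assms(3)[of "w + a"] assms(3)[of "w + b"]
    by (auto simp: f_def of_bool_def algebra_simps)
  moreover have "f w \<in> {0, 1}" for w by (simp add: f_def)
  ultimately obtain h where h: "bounded_sums (\<lambda>y. h y - 2 * (2*a + b) * f y)" "\<And>y. 3 * h y
      \<le> 2 * (2*a + b)"
    using packing_upper_bound[of a b f] assms(1,2) by (metis less_imp_le)
  \<comment> \<open>Integrality of \<open>h\<close> enters here and produces the floor.\<close>
  have "h y \<le> (2 * (2*a + b)) div 3" for y
    using h(2)[of y] by linarith
  then show ?thesis
    using upper_density_le[OF h(1)[unfolded f_def]] assms(1,2) by simp
qed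

lemma bounded_sums_of_bool_reflect:
  assumes "bounded_sums (\<lambda>y. h y - N * of_bool (- y \<in> A))"
  shows "bounded_sums (\<lambda>y. h (- y) - N * of_bool (y \<in> A))"
  using bounded_sums_reflect[OF assms] by simp

text \<open>The covering condition is not symmetric in \<open>a\<close> and \<open>b\<close>, but
  reflecting \<open>A\<close> in 0 exchanges their roles, which gives the second bound from the
  first argument. The numerators are ceilings, as \<open>(m + 2) div 3\<close> is
  \<open>m / 3\<close> rounded up.\<close>

lemma lower_density_covering_ge:
  fixes a b :: int
  assumes "a > 0" "b > 0" "\<And>t. t \<in> A \<or> t - a \<in> A \<or> t - (a + b) \<in> A"
  shows "lower_density A \<ge> ereal (real_of_int ((2 * (2*a + b) + 2) div 3) / (2 * (2*a + b)))"
      (is ?P)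
    and "lower_density A \<ge> ereal (real_of_int ((2 * (2*b + a) + 2) div 3) / (2 * (2*b + a)))"
        (is ?Q)
proof -
  define f :: "int \<Rightarrow> int" where "f x = of_bool (x \<in> A)" for x
  have "f w + f (w + b) + f (w + (a + b)) \<ge> 1" for w
    using assms(3)[of "w + (a + b)"] by (auto simp: f_def of_bool_def algebra_simps)
  moreover have "f w \<in> {0, 1}" for w by (simp add: f_def)
  ultimately obtain h where h: "bounded_sums (\<lambda>y. h y - 2 * (2*a + b) * f y)"
      "\<And>y. 3 * h y \<ge> 2 * (2*a + b)"
    using covering_lower_bound[of a b f] assms(1,2) by (metis less_imp_le)
  have "h y \<ge> (2 * (2*a + b) + 2) div 3" for y
    using h(2)[of y] by linarith
  then show ?P
    using lower_density_ge[OF h(1)[unfolded f_def]] assms(1,2) by simp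
next
  define f :: "int \<Rightarrow> int" where "f x = of_bool (- x \<in> A)" for x
  have "f w + f (w + a) + f (w + (b + a)) \<ge> 1" for w
  proof -
    have "- w - a = - (w + a)" "- w - (a + b) = - (w + (b + a))" by simp_all
    from assms(3)[of "- w", unfolded this] show ?thesis by (auto simp: f_def of_bool_def)
  qed
  moreover have "f w \<in> {0, 1}" for w by (simp add: f_def)
  ultimately obtain h where h: "bounded_sums (\<lambda>y. h y - 2 * (2*b + a) * f y)"
      "\<And>y. 3 * h y \<ge> 2 * (2*b + a)"
    using covering_lower_bound[of b a f] assms(1,2) by (metis less_imp_le)
  have "h (- y) \<ge> (2 * (2*b + a) + 2) div 3" for y
    using h(2)[of "- y"] by linarith
  then show ?Q
    using lower_density_ge[OF bounded_sums_of_bool_reflect[OF h(1)[unfolded f_def]]] assms(1,2)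
        by simp
qed

section \<open>Periodic sets and the extremal examples\<close>

text \<open>Multiplication by the unit \<open>c\<close> maps any \<open>N\<close> consecutive
  integers bijectively onto the residues modulo \<open>N\<close>.\<close>

lemma sum_residues_window:
  fixes N c y :: int
  assumes "N > 0" "coprime c N"
  shows "(\<Sum>x\<in>{y..<y + N}. of_bool (P (x * c mod N))) = int (card {q \<in> {0..<N}. P q})"
proof -
  have "inj_on (\<lambda>x. x * c mod N) {y..<y + N}"
  proof (rule inj_onI)
    fix u v assume uv: "u \<in> {y..<y + N}" "v \<in> {y..<y + N}" "u * c mod N = v * c mod N"
    then have "N dvd (u - v) * c" by (simp add: mod_eq_dvd_iff left_diff_distrib)
    then have "N dvd u - v" using assms(2) by (metis coprime_commute coprime_dvd_mult_left_iff)
    moreover have "\<bar>u - v\<bar> < N" using uv by auto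
    ultimately show "u = v" using zdvd_not_zless[of "\<bar>u - v\<bar>" N] by fastforce
  qed
  moreover have "(\<lambda>x. x * c mod N) ` {y..<y + N} \<subseteq> {0..<N}" using assms(1) by auto
  ultimately have "bij_betw (\<lambda>x. x * c mod N) {y..<y + N} {0..<N}"
    by (simp add: bij_betw_def card_image card_subset_eq)
  from sum.reindex_bij_betw[OF this, of "\<lambda>q. of_bool (P q) :: int"]
  show ?thesis using card_eq_sum_of_bool[of "{0..<N}" "{q. P q}"]
      by (simp add: Int_def conj_commute)
qed

text \<open>All windows of length \<open>N\<close> contain equally many points, so a constant
  \<open>h\<close> serves in both density bounds, and these squeeze the two densities
  together.\<close>

lemma density_residues:
  fixes N c :: int
  assumes "N > 0" "coprime c N"
  shows "upper_density {x. P (x * c mod N)} = ereal (real (card {q \<in> {0..<N}. P q}) / N)"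
    and "lower_density {x. P (x * c mod N)} = ereal (real (card {q \<in> {0..<N}. P q}) / N)"
proof -
  let ?A = "{x. P (x * c mod N)}" and ?K = "int (card {q \<in> {0..<N}. P q})"
  have "bounded_sums (\<lambda>y. (\<Sum>x\<in>{y + 0..<y + N}. of_bool (x \<in> ?A)) - (N - 0) * of_bool (y \<in> ?A))"
    using assms(1) by (intro bounded_sums_window[where B = 1]) auto
  then have "bounded_sums (\<lambda>y. ?K - N * of_bool (y \<in> ?A))"
    by (simp add: sum_residues_window[OF assms])
  from upper_density_le[OF this order_refl assms(1)] lower_density_ge[OF this order_refl assms(1)]
    lower_density_le_upper_density[of ?A]
  show "upper_density ?A = ereal (real (card {q \<in> {0..<N}. P q}) / N)"
    "lower_density ?A = ereal (real (card {q \<in> {0..<N}. P q}) / N)"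
    by simp_all
qed

lemma card_multiples_of_3:
  fixes N :: int
  assumes "N \<ge> 0"
  shows "int (card {q \<in> {0..<N}. q mod 3 = 0}) = (N + 2) div 3"
proof -
  have "{q \<in> {0..<N}. q mod 3 = 0} = (\<lambda>k. 3 * k) ` {0..<(N + 2) div 3}"
    by (auto simp: image_iff; presburger)
  then show ?thesis using assms by (simp add: card_image inj_on_def)
qed

lemma card_multiples_of_3_fitting:
  fixes N :: int
  assumes "N \<ge> 0"
  shows "int (card {q \<in> {0..<N}. q mod 3 = 0 \<and> q + 3 \<le> N}) = N div 3"
proof -
  have "{q \<in> {0..<N}. q mod 3 = 0 \<and> q + 3 \<le> N} = (\<lambda>k. 3 * k) ` {0..<N div 3}"
    by (auto simp: image_iff; presburger)
  then show ?thesis using assms by (simp add: card_image inj_on_def)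
qed

text \<open>With \<open>c\<close> an inverse of \<open>d\<close> modulo \<open>N\<close>, the
  coordinate \<open>x * c mod N\<close> turns steps of length \<open>d\<close> into unit
  steps.\<close>

lemma inverse_coordinate:
  fixes d N :: int
  assumes "coprime d N"
  obtains c where "coprime c N" "\<And>x y j. N dvd x - y - j * d \<Longrightarrow> x * c mod N = (y * c + j) mod N"
proof -
  obtain c v where cv: "c * d + v * N = 1"
    using bezout_int[of d N] assms by auto
  have "coprime c N"
    by (rule coprimeI) (metis cv dvd_add dvd_mult dvd_mult2)
  moreover have "x * c mod N = (y * c + j) mod N" if "N dvd x - y - j * d" for x y j
  proof -
    have "x * c - (y * c + j) = (x - y - j * d) * c - j * v * N"
      using arg_cong[OF cv, of "\<lambda>z. j * z"] by (simp add: algebra_simps)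
    then show ?thesis using that by (simp add: mod_eq_dvd_iff)
  qed
  ultimately show ?thesis using that by blast
qed

lemma periodic_packing:
  fixes d N :: int
  assumes "N > 0" "coprime d N"
  obtains A where "upper_density A = ereal ((N div 3) / N)"
    "\<And>x y j. x \<in> A \<Longrightarrow> y \<in> A \<Longrightarrow> j \<in> {-2, -1, 1, 2} \<Longrightarrow> \<not> N dvd x - y - j * d"
proof -
  obtain c where c: "coprime c N" "\<And>x y j. N dvd x - y - j * d \<Longrightarrow> x * c mod N = (y * c + j) mod N"
    using inverse_coordinate[OF assms(2)] by blast
  \<comment> \<open>Requiring \<open>q + 3 \<le> N\<close> keeps the gap across the wrap-around at
    least 3.\<close>
  define P where "P q \<longleftrightarrow> q mod 3 = 0 \<and> q + 3 \<le> N" for q :: int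
  let ?A = "{x. P (x * c mod N)}"
  have card: "int (card {q \<in> {0..<N}. P q}) = N div 3"
    unfolding P_def using card_multiples_of_3_fitting assms(1) by simp
  have "upper_density ?A = ereal ((N div 3) / N)"
    using density_residues(1)[OF assms(1) c(1), of P] by (simp flip: card)
  moreover have "\<not> N dvd x - y - j * d" if "x \<in> ?A" "y \<in> ?A" "j \<in> {-2, -1, 1, 2}" for x y j
  proof
    assume "N dvd x - y - j * d"
    then have "x * c mod N = (y * c mod N + j) mod N" using c(2) by (simp add: mod_add_left_eq)
    moreover define p q where "p = x * c mod N" and "q = y * c mod N"
    moreover have "0 \<le> p" "0 \<le> q" "P p" "P q"
      using assms(1) that by (auto simp: p_def q_def)
    \<comment> \<open>Since \<open>j \<le> 2\<close> and \<open>q + 3 \<le> N\<close>, a wrap can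
      only occur below 0.\<close>
    moreover have "(q + j) mod N = (if q + j < 0 then q + j + N else q + j)"
    proof (cases "q + j < 0")
      case True
      have "(q + j) mod N = (q + j + N) mod N" by simp
      also have "\<dots> = q + j + N"
        using True that(3) \<open>0 \<le> q\<close> \<open>P q\<close> by (intro mod_pos_pos_trivial) (auto simp: P_def)
      finally show ?thesis using True by simp
    next
      case False
      then show ?thesis using that(3) \<open>P q\<close> by (auto simp: P_def intro!: mod_pos_pos_trivial)
    qed
    ultimately have "p = q + j \<or> p = q + j + N" by (auto split: if_splits)
    moreover have "p + 3 \<le> N" "q mod 3 = 0" "p mod 3 = 0" using \<open>P p\<close> \<open>P q\<close> by (auto simp: P_def)
    \<comment> \<open>Without a wrap, \<open>p - q = j\<close> is not divisible by 3; with one,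
      \<open>p \<ge> N - 2\<close>.\<close>
    ultimately show False using that(3) \<open>0 \<le> q\<close> by (elim insertE disjE) (simp_all, presburger+)
  qed
  ultimately show ?thesis using that by blast
qed

lemma periodic_covering:
  fixes d N :: int
  assumes "N > 0" "coprime d N"
  obtains A where "lower_density A = ereal (((N + 2) div 3) / N)"
    "\<And>y. \<exists>j\<in>{0, 1, 2}. \<forall>x. N dvd x - y - j * d \<longrightarrow> x \<in> A"
proof -
  obtain c where c: "coprime c N" "\<And>x y j. N dvd x - y - j * d \<Longrightarrow> x * c mod N = (y * c + j) mod N"
    using inverse_coordinate[OF assms(2)] by blast
  define P where "P q \<longleftrightarrow> q mod 3 = 0" for q :: int
  let ?A = "{x. P (x * c mod N)}"
  have card: "int (card {q \<in> {0..<N}. P q}) = (N + 2) div 3"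
    unfolding P_def using card_multiples_of_3 assms(1) by simp
  have "lower_density ?A = ereal (((N + 2) div 3) / N)"
    using density_residues(2)[OF assms(1) c(1), of P] by (simp flip: card)
  moreover have "\<exists>j\<in>{0, 1, 2}. \<forall>x. N dvd x - y - j * d \<longrightarrow> x \<in> ?A" for y
  proof -
    define q where "q = y * c mod N"
    have q: "0 \<le> q" "q < N" using assms(1) by (auto simp: q_def)
    have step: "(q + j) mod N = q + j" if "q + j < N" "0 \<le> j" for j
      using that q by (intro mod_pos_pos_trivial) auto
    have "\<exists>j\<in>{0, 1, 2}. P ((q + j) mod N)"
    \<comment> \<open>If the three residues wrap around, one of them is 0, which is in the set;
      otherwise they are consecutive integers.\<close>
    proof (cases "q + 1 = N \<or> q + 2 = N")
      case True
      then show ?thesis by (auto simp: P_def)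
    next
      case False
      then have "q + 1 < N" "q + 2 < N" using q(2) by linarith+
      moreover have "q mod 3 = 0 \<or> (q + 1) mod 3 = 0 \<or> (q + 2) mod 3 = 0" by presburger
      ultimately show ?thesis using step[of 0] step[of 1] step[of 2] q(2) by (simp add: P_def)
    qed
    moreover have "(q + j) mod N = (y * c + j) mod N" for j by (simp add: q_def mod_add_left_eq)
    ultimately show ?thesis using c(2) by (metis (mono_tags, lifting) mem_Collect_eq)
  qed
  ultimately show ?thesis using that by blast
qed

text \<open>The differences \<open>a\<close>, \<open>b\<close>, \<open>a + b\<close> are -2, 1, -1
  times \<open>b\<close> modulo \<open>a + 2*b\<close>, and 1, -2, -1 times \<open>a\<close> modulo
  \<open>2*a + b\<close>. Both multipliers are units by coprimality.\<close>

lemma packing_density_ge: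
  fixes a b :: int
  assumes "a > 0" "b > 0" "coprime a b"
  shows "packing_density {0, a, a + b} \<ge> ereal (real_of_int ((a + 2*b) div 3) / (a + 2*b))" (is ?P)
    and "packing_density {0, a, a + b} \<ge> ereal (real_of_int ((2*a + b) div 3) / (2*a + b))" (is ?Q)
proof -
  have ge: "packing_density {0, a, a + b} \<ge> upper_density A"
    if "\<And>x. x \<in> A \<Longrightarrow> x + a \<notin> A \<and> x + b \<notin> A \<and> x + (a + b) \<notin> A" for A
    unfolding packing_density_def using that assms by (intro SUP_upper) (simp add: packing_set_iff)
  have "coprime b (a + 2*b)" "coprime a (2*a + b)"
    using assms(3) gcd_add_mult[of b 2 a] gcd_add_mult[of a 2 b]
    by (simp_all add: coprime_iff_gcd_eq_1 gcd.commute add.commute)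
  note cop = this
  obtain A where A: "upper_density A = ereal (real_of_int ((a + 2*b) div 3) / (a + 2*b))"
    "\<And>x y j. x \<in> A \<Longrightarrow> y \<in> A \<Longrightarrow> j \<in> {-2, -1, 1, 2} \<Longrightarrow> \<not> (a + 2*b) dvd x - y - j * b"
    using periodic_packing[OF _ cop(1)] assms by auto
  have "x + a \<notin> A \<and> x + b \<notin> A \<and> x + (a + b) \<notin> A" if "x \<in> A" for x
    using A(2)[of "x + a" x "-2"] A(2)[of "x + b" x 1] A(2)[of "x + (a + b)" x "-1"] that
    by (auto simp: algebra_simps)
  from ge[OF this] show ?P by (simp add: A(1))
  obtain A where A: "upper_density A = ereal (real_of_int ((2*a + b) div 3) / (2*a + b))"
    "\<And>x y j. x \<in> A \<Longrightarrow> y \<in> A \<Longrightarrow> j \<in> {-2, -1, 1, 2} \<Longrightarrow> \<not> (2*a + b) dvd x - y - j * a"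
    using periodic_packing[OF _ cop(2)] assms by auto
  have "x + a \<notin> A \<and> x + b \<notin> A \<and> x + (a + b) \<notin> A" if "x \<in> A" for x
    using A(2)[of "x + b" x "-2"] A(2)[of "x + a" x 1] A(2)[of "x + (a + b)" x "-1"] that
    by (auto simp: algebra_simps)
  from ge[OF this] show ?Q by (simp add: A(1))
qed

lemma covering_density_le:
  fixes a b :: int
  assumes "a > 0" "b > 0" "coprime a b"
  shows "covering_density {0, a, a + b} \<le> ereal (real_of_int ((a + 2*b + 2) div 3) / (a + 2*b))"
      (is ?P)
    and "covering_density {0, a, a + b} \<le> ereal (real_of_int ((2*a + b + 2) div 3) / (2*a + b))"
        (is ?Q)
proof -
  have le: "covering_density {0, a, a + b} \<le> lower_density A"
    if "\<And>t. t \<in> A \<or> t - a \<in> A \<or> t - (a + b) \<in> A" for A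
    unfolding covering_density_def using that by (intro INF_lower) (simp add: covering_set_iff)
  have "coprime b (a + 2*b)" "coprime a (2*a + b)"
    using assms(3) gcd_add_mult[of b 2 a] gcd_add_mult[of a 2 b]
    by (simp_all add: coprime_iff_gcd_eq_1 gcd.commute add.commute)
  note cop = this
  obtain A where A: "lower_density A = ereal (real_of_int ((a + 2*b + 2) div 3) / (a + 2*b))"
    "\<And>y. \<exists>j\<in>{0, 1, 2}. \<forall>x. (a + 2*b) dvd x - y - j * b \<longrightarrow> x \<in> A"
    using periodic_covering[OF _ cop(1)] assms by auto
  have "t \<in> A \<or> t - a \<in> A \<or> t - (a + b) \<in> A" for t
  proof -
    \<comment> \<open>Modulo \<open>a + 2*b\<close>, the three candidates are \<open>t\<close>,
      \<open>t + b\<close> and \<open>t + 2*b\<close>.\<close>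
    have "(a + 2*b) dvd t - t - 0 * b" "(a + 2*b) dvd (t - (a + b)) - t - 1 * b"
        "(a + 2*b) dvd (t - a) - t - 2 * b"
      by (auto intro: dvdI[of _ _ "-1"])
    then show ?thesis using A(2)[of t] by blast
  qed
  from le[OF this] show ?P by (simp add: A(1))
  obtain A where A: "lower_density A = ereal (real_of_int ((2*a + b + 2) div 3) / (2*a + b))"
    "\<And>y. \<exists>j\<in>{0, 1, 2}. \<forall>x. (2*a + b) dvd x - y - j * a \<longrightarrow> x \<in> A"
    using periodic_covering[OF _ cop(2)] assms by auto
  have "t \<in> A \<or> t - a \<in> A \<or> t - (a + b) \<in> A" for t
  proof -
    \<comment> \<open>Here the progression of step \<open>a\<close> must start at
      \<open>t - a\<close>.\<close>
    have "(2*a + b) dvd (t - a) - (t - a) - 0 * a" "(2*a + b) dvd t - (t - a) - 1 * a"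
      "(2*a + b) dvd (t - (a + b)) - (t - a) - 2 * a"
      by (auto intro: dvdI[of _ _ "-1"])
    then show ?thesis using A(2)[of "t - a"] by blast
  qed
  from le[OF this] show ?Q by (simp add: A(1))
qed

section \<open>Cancelling the factor 2, and the exact values\<close>

text \<open>Doubling a remainder 0 or 1 stays below 3, so rounding down commutes with doubling;
  remainder 2 would gain one.\<close>

lemma floor_double_third:
  fixes N :: int
  assumes "N mod 3 \<noteq> 2"
  shows "real_of_int ((2 * N) div 3) / (2 * N) = (N div 3) / N"
proof -
  have "(2 * N) div 3 = 2 * (N div 3)" using assms by presburger
  then show ?thesis by simp
qed

text \<open>The deficit to the next multiple of 3 is 0 or 1 here, so doubling it causes no change in
  rounding up.\<close>

lemma ceiling_double_third:
  fixes N :: int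
  assumes "N mod 3 \<noteq> 1"
  shows "real_of_int ((2 * N + 2) div 3) / (2 * N) = ((N + 2) div 3) / N"
proof -
  have "(2 * N + 2) div 3 = 2 * ((N + 2) div 3)" using assms by presburger
  then show ?thesis by simp
qed

lemma packing_density_three_points:
  fixes a b :: int
  assumes "a > 0" "b > 0" "coprime a b"
  shows "packing_density {0, a, a + b} =
    ereal (max (real_of_int ((a + 2*b) div 3) / (a + 2*b))
        (real_of_int ((2*a + b) div 3) / (2*a + b)))"
proof (rule antisym)
  show "packing_density {0, a, a + b} \<le> ereal (max (real_of_int ((a + 2*b) div 3) / (a + 2*b))
      (real_of_int ((2*a + b) div 3) / (2*a + b)))"
    unfolding packing_density_def
  proof (rule SUP_least)
    fix A assume "A \<in> {A. packing_set {0, a, a + b} A}"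
    then have A: "x + a \<notin> A \<and> x + b \<notin> A \<and> x + (a + b) \<notin> A" if "x \<in> A" for x
      using assms that by (simp add: packing_set_iff)
    then have A': "x + b \<notin> A \<and> x + a \<notin> A \<and> x + (b + a) \<notin> A" if "x \<in> A" for x
      using A[OF that] by (simp add: add.commute[of b a])
    have up: "upper_density A \<le> ereal (real_of_int ((2 * (2*a + b)) div 3) / (2 * (2*a + b)))"
      "upper_density A \<le> ereal (real_of_int ((2 * (2*b + a)) div 3) / (2 * (2*b + a)))"
      using upper_density_packing_le A A' assms(1,2) by blast+
    \<comment> \<open>The two numbers sum to \<open>3 * (a + b)\<close>, so they cannot both have
      remainder 2; one good bound suffices below the maximum.\<close>
    have "(2*a + b) mod 3 \<noteq> 2 \<or> (2*b + a) mod 3 \<noteq> 2" by presburger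
    then show "upper_density A \<le> ereal (max (real_of_int ((a + 2*b) div 3) / (a + 2*b))
        (real_of_int ((2*a + b) div 3) / (2*a + b)))"
    proof
      assume "(2*a + b) mod 3 \<noteq> 2"
      from up(1)[unfolded floor_double_third[OF this]] show ?thesis
        by (rule order_trans) (simp only: ereal_less_eq max.cobounded2)
    next
      assume "(2*b + a) mod 3 \<noteq> 2"
      from up(2)[unfolded floor_double_third[OF this]] show ?thesis
        by (rule order_trans) (simp add: add.commute)
    qed
  qed
  show "ereal (max (real_of_int ((a + 2*b) div 3) / (a + 2*b))
      (real_of_int ((2*a + b) div 3) / (2*a + b))) \<le> packing_density {0, a, a + b}"
    using packing_density_ge[OF assms] by (simp add: max_def)
qed

lemma covering_density_three_points:
  fixes a b :: int
  assumes "a > 0" "b > 0" "coprime a b"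
  shows "covering_density {0, a, a + b} =
    ereal (min (real_of_int ((a + 2*b + 2) div 3) / (a + 2*b))
        (real_of_int ((2*a + b + 2) div 3) / (2*a + b)))"
proof (rule antisym)
  show "ereal (min (real_of_int ((a + 2*b + 2) div 3) / (a + 2*b))
      (real_of_int ((2*a + b + 2) div 3) / (2*a + b))) \<le> covering_density {0, a, a + b}"
    unfolding covering_density_def
  proof (rule INF_greatest)
    fix A assume "A \<in> {A. covering_set {0, a, a + b} A}"
    then have A: "t \<in> A \<or> t - a \<in> A \<or> t - (a + b) \<in> A" for t
      by (simp add: covering_set_iff)
    note low = lower_density_covering_ge[OF assms(1,2) A]
    \<comment> \<open>Likewise both remainders cannot be 1, and either bound lies above the
      minimum.\<close>
    have "(2*a + b) mod 3 \<noteq> 1 \<or> (2*b + a) mod 3 \<noteq> 1" by presburger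
    then show "ereal (min (real_of_int ((a + 2*b + 2) div 3) / (a + 2*b))
        (real_of_int ((2*a + b + 2) div 3) / (2*a + b))) \<le> lower_density A"
    proof
      assume "(2*a + b) mod 3 \<noteq> 1"
      from low(1)[unfolded ceiling_double_third[OF this]] show ?thesis
        by (rule order_trans[rotated]) (simp only: ereal_less_eq min.cobounded2)
    next
      assume "(2*b + a) mod 3 \<noteq> 1"
      from low(2)[unfolded ceiling_double_third[OF this]] show ?thesis
        by (rule order_trans[rotated]) (simp add: add.commute)
    qed
  qed
  show "covering_density {0, a, a + b} \<le> ereal (min (real_of_int ((a + 2*b + 2) div 3) / (a
      + 2*b)) (real_of_int ((2*a + b + 2) div 3) / (2*a + b)))"
    using covering_density_le[OF assms] by (simp add: min_def)
qed

lemma floor_third: "\<lfloor>(1/3) * real_of_int k\<rfloor> = k div 3"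
  using floor_divide_of_int_eq[of k 3, where ?'a = real] by simp

lemma ceiling_third: "\<lceil>(1/3) * real_of_int k\<rceil> = (k + 2) div 3"
proof -
  have "\<lceil>(1/3) * real_of_int k\<rceil> = - ((- k) div 3)"
    using floor_third[of "- k"] by (simp add: ceiling_def)
  then show ?thesis by presburger
qed

theorem theorem1:
  fixes l1 l2 :: nat and S :: "int set"
  assumes "l1 > 0" and "l2 > 0" and "coprime l1 l2"
    and "S = {0, int l1, int l1 + int l2}"
  shows "packing_density S =
           ereal (max (of_int \<lfloor>(1/3) * (real l1 + 2 * real l2)\<rfloor> / (real l1 + 2 * real l2))
                      (of_int \<lfloor>(1/3) * (2 * real l1 + real l2)\<rfloor> / (2 * real l1 + real l2)))
       \<and> covering_density S =
           ereal (min (of_int \<lceil>(1/3) * (real l1 + 2 * real l2)\<rceil> / (real l1 + 2 * real l2))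
                      (of_int \<lceil>(1/3) * (2 * real l1 + real l2)\<rceil> / (2 * real l1 + real l2)))"
proof -
  define a b where "a = int l1" and "b = int l2"
  have "real l1 + 2 * real l2 = of_int (a + 2*b)" "2 * real l1 + real l2 = of_int (2*a + b)"
    by (simp_all add: a_def b_def)
  moreover have "a > 0" "b > 0" "coprime a b" "S = {0, a, a + b}"
    using assms by (simp_all add: a_def b_def)
  ultimately show ?thesis
    by (simp only: floor_third ceiling_third packing_density_three_points covering_density_three_points)
qed

end
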